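(* Let $k$ be a field, $\mathfrak{L}$ a Leibniz algebra over $k$, $E$ a $k$-vector space and $\pi : E \to \mathfrak{L}$ a surjective linear map with $\mathfrak{g} = \mathrm{Ker}(\pi)$. Then $\approx$ is an equivalence relation on the set $\mathcal{CS}(\mathfrak{L},\mathfrak{g})$ of all crossed systems of $\mathfrak{L}$ by $\mathfrak{g}$. If $\mathbb{GHL}^2(\mathfrak{L},\mathfrak{g}) := \mathcal{CS}(\mathfrak{L},\mathfrak{g})/\approx$, then the map $$\mathbb{GHL}^2(\mathfrak{L},\mathfrak{g}) \to \mathrm{Gext}(E,\mathfrak{L}), \qquad \overline{(\triangleleft,\triangleright,f,[-,-]_{\mathfrak{g}})} \longmapsto \mathfrak{g} \#_{(\triangleleft,\triangleright,f,[-,-]_{\mathfrak{g}})} \mathfrak{L}$$ is a bijection between $\mathbb{GHL}^2(\mathfrak{L},\mathfrak{g})$ and $\mathrm{Gext}(E,\mathfrak{L})$.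
   Context: All vector spaces and (bi)linear maps are over an arbitrary field $k$. A Leibniz algebra is a vector space with a bilinear bracket satisfying $[x,[y,z]] = [[x,y],z] - [[x,z],y]$. Crossed systems: for a Leibniz algebra $\mathfrak{L}$ and a vector space $\mathfrak{g}$, a crossed system of $\mathfrak{L}$ by $\mathfrak{g}$ is a quadruple $(\triangleleft,\triangleright,f,[-,-]_{\mathfrak{g}})$ of bilinear maps $\triangleleft : \mathfrak{g}\times\mathfrak{L}\to\mathfrak{g}$, $\triangleright : \mathfrak{L}\times\mathfrak{g}\to\mathfrak{g}$, $f : \mathfrak{L}\times\mathfrak{L}\to\mathfrak{g}$, $[-,-]_{\mathfrak{g}} : \mathfrak{g}\times\mathfrak{g}\to\mathfrak{g}$ such that the vector space $\mathfrak{g}\times\mathfrak{L}$ with the bracket $\{(g,x),(h,y)\} := ([g,h]_{\mathfrak{g}} + x\triangleright h + g\triangleleft y + f(x,y), [x,y])$ is a Leibniz algebra; this Leibniz algebra is the crossed product $\mathfrak{g}\#\mathfrak{L} = \mathfrak{g}\#_{(\triangleleft,\triangleright,f,[-,-]_{\mathfrak{g}})}\mathfrak{L}$. Relation $\approx$ on crossed systems: $(\triangleleft,\triangleright,f,[-,-]_{\mathfrak{g}}) \approx (\triangleleft',\triangleright',f',[-,-]'_{\mathfrak{g}})$ if and only if $[-,-]_{\mathfrak{g}} = [-,-]'_{\mathfrak{g}}$ and there exists a linear map $r:\mathfrak{L}\to\mathfrak{g}$ such that for all $g\in\mathfrak{g}$, $x,y\in\mathfrak{L}$: $g\triangleleft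 x = g\triangleleft' x + [g,r(x)]_{\mathfrak{g}}$; $x\triangleright g = x\triangleright' g + [r(x),g]_{\mathfrak{g}}$; $f(x,y) = f'(x,y) + [r(x),r(y)]_{\mathfrak{g}} - r([x,y]) + x\triangleright' r(y) + r(x)\triangleleft' y$. $\mathrm{Gext}(E,\mathfrak{L})$: consider all Leibniz algebra structures $\{-,-\}_E$ on the vector space $E$ for which $\pi : (E,\{-,-\}_E)\to\mathfrak{L}$ is a morphism of Leibniz algebras. Two such structures $\{-,-\}_E$, $\{-,-\}'_E$ are cohomologous if there is a Leibniz algebra morphism (necessarily an isomorphism) $\varphi : (E,\{-,-\}_E)\to(E,\{-,-\}'_E)$ with $\varphi|_{\mathfrak{g}} = \mathrm{Id}_{\mathfrak{g}}$ and $\pi\circ\varphi=\pi$. $\mathrm{Gext}(E,\mathfrak{L})$ is the set of equivalence classes. The crossed product $\mathfrak{g}\#\mathfrak{L}$, whose underlying space is $\mathfrak{g}\times\mathfrak{L}$, is regarded as an element of $\mathrm{Gext}(E,\mathfrak{L})$ by transporting its bracket to $E$ along a linear isomorphism $\mathfrak{g}\times\mathfrak{L}\to E$, $(g,x)\mapsto g+s(x)$, where $s:\mathfrak{L}\to E$ is a linear section of $\pi$; the resulting class does not depend on $s$. *)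

theory Defs
  imports "HOL-Analysis.Product_Vector" "HOL-Library.FuncSet"
begin

text \<open>
  Vector spaces over a field \<open>'k\<close> are given by a scalar multiplication \<open>s\<close> with
  \<^term>\<open>vector_space s\<close>. Since the kernel of a linear map is a subspace and not a type,
  bilinear maps and Leibniz algebras are formulated on subspaces (carriers); \<^term>\<open>UNIV\<close> as
  carrier gives the structures on a whole type.
\<close>

definition bilinear_on ::
  "('k::field \<Rightarrow> 'a::ab_group_add \<Rightarrow> 'a) \<Rightarrow> 'a set \<Rightarrow>
   ('k \<Rightarrow> 'b::ab_group_add \<Rightarrow> 'b) \<Rightarrow> 'b set \<Rightarrow>
   ('k \<Rightarrow> 'c::ab_group_add \<Rightarrow> 'c) \<Rightarrow> 'c set \<Rightarrow> ('a \<times> 'b \<Rightarrow> 'c) \<Rightarrow> bool"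
  where
  "bilinear_on sV V sW W sU U B \<longleftrightarrow>
     B \<in> V \<times> W \<rightarrow> U \<and>
     (\<forall>v\<in>V. \<forall>v'\<in>V. \<forall>w\<in>W. B (v + v', w) = B (v, w) + B (v', w)) \<and>
     (\<forall>v\<in>V. \<forall>w\<in>W. \<forall>w'\<in>W. B (v, w + w') = B (v, w) + B (v, w')) \<and>
     (\<forall>a. \<forall>v\<in>V. \<forall>w\<in>W. B (sV a v, w) = sU a (B (v, w))) \<and>
     (\<forall>a. \<forall>v\<in>V. \<forall>w\<in>W. B (v, sW a w) = sU a (B (v, w)))"

locale leibniz_algebra = vector_space scale
  for scale :: "'k::field \<Rightarrow> 'v::ab_group_add \<Rightarrow> 'v" +
  fixes V :: "'v set" and br :: "'v \<times> 'v \<Rightarrow> 'v"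
  assumes subspace_carrier: "subspace V"
    and bilinear_bracket: "bilinear_on scale V scale V scale V br"
    and leibniz_identity:
      "\<lbrakk>x \<in> V; y \<in> V; z \<in> V\<rbrakk> \<Longrightarrow> br (x, br (y, z)) = br (br (x, y), z) - br (br (x, z), y)"

definition leibniz_hom ::
  "('k::field \<Rightarrow> 'a::ab_group_add \<Rightarrow> 'a) \<Rightarrow> ('a \<times> 'a \<Rightarrow> 'a) \<Rightarrow>
   ('k \<Rightarrow> 'b::ab_group_add \<Rightarrow> 'b) \<Rightarrow> ('b \<times> 'b \<Rightarrow> 'b) \<Rightarrow> ('a \<Rightarrow> 'b) \<Rightarrow> bool"
  where
  "leibniz_hom s1 br1 s2 br2 \<phi> \<longleftrightarrow>
     Vector_Spaces.linear s1 s2 \<phi> \<and> (\<forall>x y. \<phi> (br1 (x, y)) = br2 (\<phi> x, \<phi> y))"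

type_synonym ('g, 'l) quadruple =
  "('g \<times> 'l \<Rightarrow> 'g) \<times> ('l \<times> 'g \<Rightarrow> 'g) \<times> ('l \<times> 'l \<Rightarrow> 'g) \<times> ('g \<times> 'g \<Rightarrow> 'g)"

fun crossed_bracket ::
  "('l \<times> 'l \<Rightarrow> 'l) \<Rightarrow> ('g::ab_group_add, 'l) quadruple \<Rightarrow>
   ('g \<times> 'l) \<times> ('g \<times> 'l) \<Rightarrow> 'g \<times> 'l"
  where
  "crossed_bracket brL (ra, la, f, brg) ((g, x), (h, y)) =
     (brg (g, h) + la (x, h) + ra (g, y) + f (x, y), brL (x, y))"

text \<open>
  Crossed systems of the Leibniz algebra \<open>(sL, brL)\<close> by the subspace \<open>G\<close>. The maps are
  required to be extensional, i.e. they carry no information outside their domains, so that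
  equal maps on \<open>G \<times> L\<close> etc. are equal as functions.
\<close>

definition crossed_systems ::
  "('k::field \<Rightarrow> 'l::ab_group_add \<Rightarrow> 'l) \<Rightarrow> ('l \<times> 'l \<Rightarrow> 'l) \<Rightarrow>
   ('k \<Rightarrow> 'g::ab_group_add \<Rightarrow> 'g) \<Rightarrow> 'g set \<Rightarrow> ('g, 'l) quadruple set"
  where
  "crossed_systems sL brL sG G =
     {(ra, la, f, brg).
        ra \<in> extensional (G \<times> UNIV) \<and> bilinear_on sG G sL UNIV sG G ra \<and>
        la \<in> extensional (UNIV \<times> G) \<and> bilinear_on sL UNIV sG G sG G la \<and>
        bilinear_on sL UNIV sL UNIV sG G f \<and>
        brg \<in> extensional (G \<times> G) \<and> bilinear_on sG G sG G sG G brg \<and>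
        leibniz_algebra (module_prod.scale sG sL) (G \<times> UNIV)
          (crossed_bracket brL (ra, la, f, brg))}"

definition crossed_equiv ::
  "('k::field \<Rightarrow> 'l::ab_group_add \<Rightarrow> 'l) \<Rightarrow> ('l \<times> 'l \<Rightarrow> 'l) \<Rightarrow>
   ('k \<Rightarrow> 'g::ab_group_add \<Rightarrow> 'g) \<Rightarrow> 'g set \<Rightarrow>
   (('g, 'l) quadruple \<times> ('g, 'l) quadruple) set"
  where
  "crossed_equiv sL brL sG G =
     {((ra, la, f, brg), (ra', la', f', brg')).
        (ra, la, f, brg) \<in> crossed_systems sL brL sG G \<and>
        (ra', la', f', brg') \<in> crossed_systems sL brL sG G \<and>
        brg = brg' \<and>
        (\<exists>r. Vector_Spaces.linear sL sG r \<and> range r \<subseteq> G \<and>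
          (\<forall>g\<in>G. \<forall>x. ra (g, x) = ra' (g, x) + brg (g, r x)) \<and>
          (\<forall>g\<in>G. \<forall>x. la (x, g) = la' (x, g) + brg (r x, g)) \<and>
          (\<forall>x y. f (x, y) =
             f' (x, y) + brg (r x, r y) - r (brL (x, y)) + la' (x, r y) + ra' (r x, y)))}"

definition GHL2 ::
  "('k::field \<Rightarrow> 'l::ab_group_add \<Rightarrow> 'l) \<Rightarrow> ('l \<times> 'l \<Rightarrow> 'l) \<Rightarrow>
   ('k \<Rightarrow> 'g::ab_group_add \<Rightarrow> 'g) \<Rightarrow> 'g set \<Rightarrow> ('g, 'l) quadruple set set"
  where
  "GHL2 sL brL sG G = crossed_systems sL brL sG G // crossed_equiv sL brL sG G"

definition ext_structures ::
  "('k::field \<Rightarrow> 'l::ab_group_add \<Rightarrow> 'l) \<Rightarrow> ('l \<times> 'l \<Rightarrow> 'l) \<Rightarrow>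
   ('k \<Rightarrow> 'e::ab_group_add \<Rightarrow> 'e) \<Rightarrow> ('e \<Rightarrow> 'l) \<Rightarrow> ('e \<times> 'e \<Rightarrow> 'e) set"
  where
  "ext_structures sL brL sE \<pi> =
     {br. leibniz_algebra sE UNIV br \<and> leibniz_hom sE br sL brL \<pi>}"

definition cohomologous ::
  "('k::field \<Rightarrow> 'l::ab_group_add \<Rightarrow> 'l) \<Rightarrow> ('l \<times> 'l \<Rightarrow> 'l) \<Rightarrow>
   ('k \<Rightarrow> 'e::ab_group_add \<Rightarrow> 'e) \<Rightarrow> ('e \<Rightarrow> 'l) \<Rightarrow>
   (('e \<times> 'e \<Rightarrow> 'e) \<times> ('e \<times> 'e \<Rightarrow> 'e)) set"
  where
  "cohomologous sL brL sE \<pi> =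
     {(br, br'). br \<in> ext_structures sL brL sE \<pi> \<and> br' \<in> ext_structures sL brL sE \<pi> \<and>
        (\<exists>\<phi>. leibniz_hom sE br sE br' \<phi> \<and> (\<forall>g. \<pi> g = 0 \<longrightarrow> \<phi> g = g) \<and> \<pi> \<circ> \<phi> = \<pi>)}"

definition Gext ::
  "('k::field \<Rightarrow> 'l::ab_group_add \<Rightarrow> 'l) \<Rightarrow> ('l \<times> 'l \<Rightarrow> 'l) \<Rightarrow>
   ('k \<Rightarrow> 'e::ab_group_add \<Rightarrow> 'e) \<Rightarrow> ('e \<Rightarrow> 'l) \<Rightarrow> ('e \<times> 'e \<Rightarrow> 'e) set set"
  where
  "Gext sL brL sE \<pi> = ext_structures sL brL sE \<pi> // cohomologous sL brL sE \<pi>"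

definition linear_sections ::
  "('k::field \<Rightarrow> 'l::ab_group_add \<Rightarrow> 'l) \<Rightarrow>
   ('k \<Rightarrow> 'e::ab_group_add \<Rightarrow> 'e) \<Rightarrow> ('e \<Rightarrow> 'l) \<Rightarrow> ('l \<Rightarrow> 'e) set"
  where
  "linear_sections sL sE \<pi> = {s. Vector_Spaces.linear sL sE s \<and> \<pi> \<circ> s = id}"

definition transport_bracket :: "('a \<Rightarrow> 'b) \<Rightarrow> 'a set \<Rightarrow> ('a \<times> 'a \<Rightarrow> 'a) \<Rightarrow> 'b \<times> 'b \<Rightarrow> 'b"
  where
  "transport_bracket \<Phi> V br = (\<lambda>(u, v). \<Phi> (br (inv_into V \<Phi> u, inv_into V \<Phi> v)))"

text \<open>The bracket of the crossed product, carried over to \<open>E\<close> along \<open>(g, x) \<mapsto> g + s x\<close>.\<close>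

definition crossed_product_on ::
  "('l \<times> 'l \<Rightarrow> 'l) \<Rightarrow> ('e::ab_group_add \<Rightarrow> 'l::ab_group_add) \<Rightarrow> ('l \<Rightarrow> 'e) \<Rightarrow>
   ('e, 'l) quadruple \<Rightarrow> 'e \<times> 'e \<Rightarrow> 'e"
  where
  "crossed_product_on brL \<pi> s c =
     transport_bracket (\<lambda>(g, x). g + s x) ({e. \<pi> e = 0} \<times> UNIV) (crossed_bracket brL c)"

text \<open>
  The map on classes, in the style of \<open>UN_equiv_class\<close>: the union is over all
  representatives and all sections, and all members of the union coincide.
\<close>

definition GHL2_to_Gext ::
  "('k::field \<Rightarrow> 'l::ab_group_add \<Rightarrow> 'l) \<Rightarrow> ('l \<times> 'l \<Rightarrow> 'l) \<Rightarrow>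
   ('k \<Rightarrow> 'e::ab_group_add \<Rightarrow> 'e) \<Rightarrow> ('e \<Rightarrow> 'l) \<Rightarrow>
   ('e, 'l) quadruple set \<Rightarrow> ('e \<times> 'e \<Rightarrow> 'e) set"
  where
  "GHL2_to_Gext sL brL sE \<pi> C =
     (\<Union>c\<in>C. \<Union>s\<in>linear_sections sL sE \<pi>.
        cohomologous sL brL sE \<pi> `` {crossed_product_on brL \<pi> s c})"

end

theory Submission
  imports Defs
begin

text \<open>
  A linear section \<open>s\<close> of \<open>\<pi>\<close> identifies \<open>E\<close> with \<open>G \<times> L\<close>, and under this identification the brackets
  on \<open>E\<close> lifting that of \<open>L\<close> are exactly the crossed brackets. A linear map \<open>\<phi>\<close> with
  \<open>\<phi>|\<^bsub>G\<^esub> = id\<close> and \<open>\<pi> \<circ> \<phi> = \<pi>\<close> has the form \<open>g + s x \<mapsto> g + r x + s' x\<close> with \<open>r : L \<rightarrow> G\<close> linear.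
  Expanding the morphism condition for such a map on \<open>G \<times> G\<close>, \<open>L \<times> G\<close>, \<open>G \<times> L\<close>, \<open>L \<times> L\<close> gives the four
  conditions defining \<open>\<approx>\<close>. Hence two crossed systems are equivalent iff their crossed
  products, formed with arbitrary and possibly different sections, are cohomologous. Everything
  else follows from this, including that \<open>\<approx>\<close> is an equivalence relation.
\<close>

section \<open>Bilinear maps and Leibniz algebras on carriers\<close>

lemma bilinear_onD:
  assumes "bilinear_on sV V sW W sU U B"
  shows "\<And>v w. \<lbrakk>v \<in> V; w \<in> W\<rbrakk> \<Longrightarrow> B (v, w) \<in> U"
    and "\<And>v v' w. \<lbrakk>v \<in> V; v' \<in> V; w \<in> W\<rbrakk> \<Longrightarrow> B (v + v', w) = B (v, w) + B (v', w)"
    and "\<And>v w w'. \<lbrakk>v \<in> V; w \<in> W; w' \<in> W\<rbrakk> \<Longrightarrow> B (v, w + w') = B (v, w) + B (v, w')"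
    and "\<And>a v w. \<lbrakk>v \<in> V; w \<in> W\<rbrakk> \<Longrightarrow> B (sV a v, w) = sU a (B (v, w))"
    and "\<And>a v w. \<lbrakk>v \<in> V; w \<in> W\<rbrakk> \<Longrightarrow> B (v, sW a w) = sU a (B (v, w))"
  using assms unfolding bilinear_on_def by (blast+)

lemma bilinear_on_zero:
  assumes "bilinear_on sV V sW W sU U B"
  shows "\<And>w. \<lbrakk>0 \<in> V; w \<in> W\<rbrakk> \<Longrightarrow> B (0, w) = 0"
    and "\<And>v. \<lbrakk>v \<in> V; 0 \<in> W\<rbrakk> \<Longrightarrow> B (v, 0) = 0"
  using bilinear_onD(2)[OF assms, of 0 0] bilinear_onD(3)[OF assms, of _ 0 0] by force+

text \<open>Each axiom for \<open>br2\<close> holds after applying \<open>\<psi>\<close>, and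
  injectivity on \<open>V2\<close> removes \<open>\<psi>\<close> again. This transfers the Leibniz
  identity both from \<open>G \<times> L\<close> to \<open>E\<close> and from \<open>E\<close> to
  \<open>G \<times> L\<close>.\<close>

lemma leibniz_algebra_pullback:
  assumes "leibniz_algebra s1 V1 br1"
    and lin: "Vector_Spaces.linear s2 s1 \<psi>"
    and sub: "module.subspace s2 V2"
    and inj: "inj_on \<psi> V2" and maps: "\<psi> \<in> V2 \<rightarrow> V1"
    and closed: "br2 \<in> V2 \<times> V2 \<rightarrow> V2"
    and hom: "\<And>u v. \<lbrakk>u \<in> V2; v \<in> V2\<rbrakk> \<Longrightarrow> \<psi> (br2 (u, v)) = br1 (\<psi> u, \<psi> v)"
  shows "leibniz_algebra s2 V2 br2"
proof -
  interpret A: leibniz_algebra s1 V1 br1 by fact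
  interpret \<psi>: Vector_Spaces.linear s2 s1 \<psi> by fact
  note B = bilinear_onD[OF A.bilinear_bracket]
  have m: "\<psi> u \<in> V1" if "u \<in> V2" for u using maps that by auto
  have c: "br2 (u, v) \<in> V2" if "u \<in> V2" "v \<in> V2" for u v using closed that by auto
  note sub' = \<psi>.vs1.subspace_add[OF sub] \<psi>.vs1.subspace_scale[OF sub] \<psi>.vs1.subspace_diff[OF sub]
  note eqI = inj_onD[OF inj]
  show ?thesis
  proof
    show "\<psi>.vs1.subspace V2" by fact
    show "bilinear_on s2 V2 s2 V2 s2 V2 br2"
      unfolding bilinear_on_def
      using closed
      by (auto intro!: eqI simp: hom c m sub' B \<psi>.add \<psi>.scale)
    show "br2 (x, br2 (y, z)) = br2 (br2 (x, y), z) - br2 (br2 (x, z), y)"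
      if "x \<in> V2" "y \<in> V2" "z \<in> V2" for x y z
      using that by (intro eqI) (simp_all add: hom c m sub' \<psi>.diff A.leibniz_identity)
  qed
qed

section \<open>Linear surjections onto a Leibniz algebra, with kernel \<open>G\<close>\<close>

locale leibniz_extension =
  L: leibniz_algebra sL UNIV brL + E: vector_space sE + \<pi>: Vector_Spaces.linear sE sL \<pi>
  for sL :: "'k::field \<Rightarrow> 'l::ab_group_add \<Rightarrow> 'l" and brL :: "'l \<times> 'l \<Rightarrow> 'l"
    and sE :: "'k \<Rightarrow> 'e::ab_group_add \<Rightarrow> 'e" and \<pi> :: "'e \<Rightarrow> 'l" +
  fixes G :: "'e set"
  assumes surj_\<pi>: "surj \<pi>" and G_eq: "G = {e. \<pi> e = 0}"
begin

sublocale vector_space_prod sE sL ..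

abbreviation "CS \<equiv> crossed_systems sL brL sE G"
abbreviation "CE \<equiv> crossed_equiv sL brL sE G"
abbreviation "Ext \<equiv> ext_structures sL brL sE \<pi>"
abbreviation "Coh \<equiv> cohomologous sL brL sE \<pi>"
abbreviation "sections \<equiv> linear_sections sL sE \<pi>"
abbreviation "cp \<equiv> crossed_product_on brL \<pi>"

lemma mem_G: "g \<in> G \<longleftrightarrow> \<pi> g = 0"
  by (simp add: G_eq)

lemma subspace_G: "E.subspace G"
  unfolding G_eq by (rule \<pi>.subspace_kernel)

lemma linear_E: "Vector_Spaces.linear sE sE \<phi>
    \<longleftrightarrow> (\<forall>u v. \<phi> (u + v) = \<phi> u + \<phi> v) \<and> (\<forall>a u. \<phi> (sE a u) = sE a (\<phi> u))"
  using E.vector_space_axioms by (simp add: Vector_Spaces.linear_iff)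

lemma linear_LE: "Vector_Spaces.linear sL sE r
    \<longleftrightarrow> (\<forall>x y. r (x + y) = r x + r y) \<and> (\<forall>a x. r (sL a x) = sE a (r x))"
  using E.vector_space_axioms L.vector_space_axioms by (simp add: Vector_Spaces.linear_iff)

lemma sectionD:
  assumes "s \<in> sections"
  shows "Vector_Spaces.linear sL sE s" and "\<pi> (s x) = x"
  using assms by (auto simp: linear_sections_def fun_eq_iff)

text \<open>A linear surjection of vector spaces splits; surjectivity of \<open>\<pi>\<close> enters
  here only.\<close>

lemma section_exists: "\<exists>s. s \<in> sections"
  using linear_surjective_right_inverse[OF \<pi>.linear_axioms surj_\<pi>]
  by (auto simp: linear_sections_def)

section \<open>Lifted brackets on \<open>E\<close> and the relation
  \<open>cohomologous\<close>\<close>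

lemma extD:
  assumes "br \<in> Ext"
  shows "leibniz_algebra sE UNIV br" and "\<pi> (br (u, v)) = brL (\<pi> u, \<pi> v)"
  using assms by (auto simp: ext_structures_def leibniz_hom_def)

text \<open>Identity and composition give reflexivity and transitivity. Symmetry needs an argument:
  \<open>\<phi>\<close> is not assumed bijective, so an inverse has to be constructed.\<close>

lemma equiv_Coh: "equiv Ext Coh"
proof (rule equivI)
  show "Coh \<subseteq> Ext \<times> Ext" by (auto simp: cohomologous_def)
  show "refl_on Ext Coh"
    by (rule refl_onI)
       (auto simp: cohomologous_def leibniz_hom_def linear_E intro!: exI[of _ "\<lambda>x. x"])
  show "trans Coh"
  proof (rule transI)
    fix a b c assume "(a, b) \<in> Coh" "(b, c) \<in> Coh"
    then obtain \<phi> \<psi> where ext: "a \<in> Ext" "c \<in> Ext"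
      and "leibniz_hom sE a sE b \<phi>" "\<forall>g. \<pi> g = 0 \<longrightarrow> \<phi> g = g" "\<pi> \<circ> \<phi> = \<pi>"
      and "leibniz_hom sE b sE c \<psi>" "\<forall>g. \<pi> g = 0 \<longrightarrow> \<psi> g = g" "\<pi> \<circ> \<psi> = \<pi>"
      by (auto simp: cohomologous_def)
    then have "leibniz_hom sE a sE c (\<psi> \<circ> \<phi>) \<and> (\<forall>g. \<pi> g = 0 \<longrightarrow> (\<psi> \<circ> \<phi>) g = g)
        \<and> \<pi> \<circ> (\<psi> \<circ> \<phi>) = \<pi>"
      by (auto simp: leibniz_hom_def linear_E fun_eq_iff)
    with ext show "(a, c) \<in> Coh" by (auto simp: cohomologous_def)
  qed
  show "sym Coh"
  proof (rule symI)
    fix a b assume "(a, b) \<in> Coh"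
    then obtain \<phi> where ext: "a \<in> Ext" "b \<in> Ext"
      and h: "leibniz_hom sE a sE b \<phi>" and k: "\<And>g. \<pi> g = 0 \<Longrightarrow> \<phi> g = g"
      and p: "\<And>u. \<pi> (\<phi> u) = \<pi> u"
      by (auto simp: cohomologous_def fun_eq_iff)
    have lin: "Vector_Spaces.linear sE sE \<phi>" and mor: "\<And>u v. \<phi> (a (u, v)) = b (\<phi> u, \<phi> v)"
      using h by (auto simp: leibniz_hom_def)
    interpret \<phi>: Vector_Spaces.linear sE sE \<phi> by (rule lin)
    \<comment> \<open>As \<open>\<phi> - id\<close> maps \<open>E\<close> into \<open>G\<close> and vanishes on \<open>G\<close>, it squares to zero.\<close>
    define \<psi> where "\<psi> u = u - (\<phi> u - u)" for u
    have fixed: "\<phi> (\<phi> u - u) = \<phi> u - u" for u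
      by (rule k) (simp add: \<pi>.diff p)
    have \<phi>\<psi>: "\<phi> (\<psi> u) = u" for u
      unfolding \<psi>_def \<phi>.diff[of u] fixed by simp
    have \<psi>\<phi>: "\<psi> (\<phi> u) = u" for u
      unfolding \<psi>_def using fixed[of u] by (simp add: \<phi>.diff)
    have "\<psi> (b (u, v)) = a (\<psi> u, \<psi> v)" for u v
      using mor[of "\<psi> u" "\<psi> v"] by (metis \<phi>\<psi> \<psi>\<phi>)
    moreover have "Vector_Spaces.linear sE sE \<psi>"
      by (simp add: linear_E \<psi>_def \<phi>.add \<phi>.scale E.scale_right_diff_distrib)
    moreover have "\<forall>g. \<pi> g = 0 \<longrightarrow> \<psi> g = g" "\<pi> \<circ> \<psi> = \<pi>"
      by (auto simp: \<psi>_def k fun_eq_iff \<pi>.diff p)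
    ultimately show "(b, a) \<in> Coh"
      using ext by (auto simp: cohomologous_def leibniz_hom_def)
  qed
qed

section \<open>Crossed products in the coordinates given by a section\<close>

lemma transport_section:
  assumes "s \<in> sections"
  shows "cp s c (u, v) = (\<lambda>(g, x). g + s x)
     (crossed_bracket brL c ((u - s (\<pi> u), \<pi> u), (v - s (\<pi> v), \<pi> v)))"
proof -
  interpret s: Vector_Spaces.linear sL sE s using sectionD(1)[OF assms] .
  \<comment> \<open>Applying \<open>\<pi>\<close> to \<open>g + s x\<close> returns
    \<open>x\<close>, so the coordinates are unique. The explicit inverse replaces
    \<open>inv_into\<close> in everything that follows.\<close>
  have "inv_into ({e. \<pi> e = 0} \<times> UNIV) (\<lambda>(g, x). g + s x) u = (u - s (\<pi> u), \<pi> u)" for u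
    by (rule inv_into_f_eq)
       (auto simp: inj_on_def \<pi>.diff sectionD(2)[OF assms],
        (metis \<pi>.add add_0 sectionD(2)[OF assms] add_right_cancel)+)
  then show ?thesis
    by (simp add: crossed_product_on_def transport_bracket_def)
qed

lemma crossed_product_on_eq:
  assumes "s \<in> sections"
  shows "cp s (ra, la, f, brg) (u, v) =
     brg (u - s (\<pi> u), v - s (\<pi> v)) + la (\<pi> u, v - s (\<pi> v)) + ra (u - s (\<pi> u), \<pi> v)
       + f (\<pi> u, \<pi> v) + s (brL (\<pi> u, \<pi> v))"
  by (simp add: transport_section[OF assms])

lemma crossed_systemD:
  assumes "(ra, la, f, brg) \<in> CS"
  shows "bilinear_on sE G sL UNIV sE G ra" and "bilinear_on sL UNIV sE G sE G la"
    and "bilinear_on sL UNIV sL UNIV sE G f" and "bilinear_on sE G sE G sE G brg"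
    and "brg \<in> extensional (G \<times> G)"
    and "leibniz_algebra scale (G \<times> UNIV) (crossed_bracket brL (ra, la, f, brg))"
  using assms by (auto simp: crossed_systems_def)

lemma minus_section_mem:
  assumes "s \<in> sections"
  shows "u - s (\<pi> u) \<in> G"
  by (simp add: mem_G \<pi>.diff sectionD(2)[OF assms])

text \<open>Taking coordinates with respect to \<open>s\<close> is an injective linear map from
  \<open>E\<close> to \<open>G \<times> L\<close> that respects the brackets, so the Leibniz
  identity pulls back along it.\<close>

lemma crossed_product_in_Ext:
  assumes c: "c \<in> CS" and s: "s \<in> sections"
  shows "cp s c \<in> Ext"
proof -
  obtain ra la f brg where c_eq: "c = (ra, la, f, brg)" by (metis prod_cases4)
  note D = crossed_systemD[OF c[unfolded c_eq]]
  interpret s: Vector_Spaces.linear sL sE s by (rule sectionD(1)[OF s])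
  note [simp] = sectionD(2)[OF s]
  \<comment> \<open>The four maps of \<open>c\<close> take values in the kernel, so under
    \<open>\<pi>\<close> only the summand \<open>s (brL (\<pi> u, \<pi> v))\<close>
    survives.\<close>
  note \<pi>G = D(1-4)[THEN bilinear_onD(1), simplified, unfolded mem_G]
  have \<pi>cp: "\<pi> (cp s c (u, v)) = brL (\<pi> u, \<pi> v)" for u v
    by (simp add: c_eq crossed_product_on_eq[OF s] \<pi>.add \<pi>.diff \<pi>G)
  let ?\<psi> = "\<lambda>u. (u - s (\<pi> u), \<pi> u)"
  have "leibniz_algebra sE UNIV (cp s c)"
  proof (rule leibniz_algebra_pullback)
    show "leibniz_algebra scale (G \<times> UNIV) (crossed_bracket brL (ra, la, f, brg))" by (rule D(6))
    show "Vector_Spaces.linear sE scale ?\<psi>"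
      using E.vector_space_axioms p.vector_space_axioms
      by (simp add: Vector_Spaces.linear_iff scale_prod \<pi>.add \<pi>.scale s.add s.scale
          E.scale_right_diff_distrib)
    show "E.subspace UNIV" by (rule E.subspace_UNIV)
    show "inj ?\<psi>" by (rule injI) auto
    show "?\<psi> \<in> UNIV \<rightarrow> G \<times> UNIV" by (simp add: minus_section_mem[OF s])
    show "?\<psi> (cp s c (u, v)) = crossed_bracket brL (ra, la, f, brg) (?\<psi> u, ?\<psi> v)" for u v
      unfolding \<pi>cp by (simp add: c_eq crossed_product_on_eq[OF s])
  qed simp
  then show ?thesis
    by (auto simp: ext_structures_def leibniz_hom_def \<pi>cp \<pi>.linear_axioms)
qed

text \<open>The crossed system is read off from \<open>br\<close> by restricting it to
  \<open>G\<close> and the image of \<open>s\<close>; the Leibniz identity pulls back along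
  \<open>(g, x) \<mapsto> g + s x\<close>.\<close>

lemma crossed_product_surj:
  assumes br: "br \<in> Ext" and s: "s \<in> sections"
  shows "\<exists>c\<in>CS. cp s c = br"
proof -
  interpret A: leibniz_algebra sE UNIV br by (rule extD(1)[OF br])
  interpret s: Vector_Spaces.linear sL sE s by (rule sectionD(1)[OF s])
  note [simp] = sectionD(2)[OF s] extD(2)[OF br]
  note B = bilinear_onD(2-5)[OF A.bilinear_bracket, simplified]
  note BL = bilinear_onD(2-5)[OF L.bilinear_bracket, simplified]
  \<comment> \<open>Consequently \<open>G\<close> is a two-sided ideal for \<open>br\<close>, so
    \<open>ra\<close>, \<open>la\<close> and \<open>brg\<close> below take values in
    \<open>G\<close>.\<close>
  have B0: "brL (0, x) = 0" "brL (x, 0) = 0" for x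
    using bilinear_on_zero[OF L.bilinear_bracket] by auto
  \<comment> \<open>\<open>restrict\<close> provides the extensionality demanded of crossed systems.
    The map \<open>f\<close> is total; it measures how far \<open>s\<close> is from preserving
    brackets, and the subtraction puts its values into \<open>G\<close>.\<close>
  define ra where "ra = restrict (\<lambda>(g, x). br (g, s x)) (G \<times> UNIV)"
  define la where "la = restrict (\<lambda>(x, g). br (s x, g)) (UNIV \<times> G)"
  define f where "f = (\<lambda>(x, y). br (s x, s y) - s (brL (x, y)))"
  define brg where "brg = restrict br (G \<times> G)"
  note defs = ra_def la_def f_def brg_def
  have Gs: "g + h \<in> G" "sE a g \<in> G" if "g \<in> G" "h \<in> G" for g h a
    using that by (auto simp: mem_G \<pi>.add \<pi>.scale)
  let ?\<psi> = "\<lambda>(g, x). g + s x"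
  have bil: "bilinear_on sE G sL UNIV sE G ra" "bilinear_on sL UNIV sE G sE G la"
      "bilinear_on sL UNIV sL UNIV sE G f" "bilinear_on sE G sE G sE G brg"
    unfolding bilinear_on_def defs
    by (auto simp: B BL B0 s.add s.scale Gs \<pi>.diff mem_G[THEN iffD1] E.scale_right_diff_distrib,
        auto simp: mem_G B0 \<pi>.diff)
  \<comment> \<open>The term subtracted in \<open>f\<close> cancels against \<open>s\<close> of the
    second component.\<close>
  have hom: "?\<psi> (crossed_bracket brL (ra, la, f, brg) (p, q)) = br (?\<psi> p, ?\<psi> q)"
    if "p \<in> G \<times> UNIV" "q \<in> G \<times> UNIV" for p q
    using that by (auto simp: defs B)
  have "leibniz_algebra scale (G \<times> UNIV) (crossed_bracket brL (ra, la, f, brg))"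
  proof (rule leibniz_algebra_pullback)
    show "leibniz_algebra sE UNIV br" by (rule extD(1)[OF br])
    show "Vector_Spaces.linear scale sE ?\<psi>"
      using E.vector_space_axioms p.vector_space_axioms
      by (auto simp: Vector_Spaces.linear_iff scale_prod s.add s.scale E.scale_right_distrib)
    show "p.subspace (G \<times> UNIV)"
      by (rule subspace_Times[OF subspace_G L.subspace_UNIV])
    show "inj_on ?\<psi> (G \<times> UNIV)"
    proof (rule inj_onI, clarify)
      fix g x h y assume mem: "g \<in> G" "h \<in> G" and eq: "g + s x = h + s y"
      from arg_cong[OF eq, of \<pi>] mem have "x = y" by (simp add: \<pi>.add mem_G)
      with eq show "g = h \<and> x = y" by simp
    qed
    show "crossed_bracket brL (ra, la, f, brg) \<in> (G \<times> UNIV) \<times> G \<times> UNIV \<rightarrow> G \<times> UNIV"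
      using bil[THEN bilinear_onD(1)] by (auto intro!: Gs)
  qed (use hom in auto)
  then have "(ra, la, f, brg) \<in> CS"
    using bil by (auto simp: crossed_systems_def defs)
  moreover have "cp s (ra, la, f, brg) = br"
  proof (rule ext, clarify)
    fix u v
    have "cp s (ra, la, f, brg) (u, v) = br (u - s (\<pi> u) + s (\<pi> u), v - s (\<pi> v) + s (\<pi> v))"
      unfolding crossed_product_on_eq[OF s] B using minus_section_mem[OF s]
      by (simp add: defs)
    then show "cp s (ra, la, f, brg) (u, v) = br (u, v)" by simp
  qed
  ultimately show ?thesis by blast
qed

text \<open>Allowing two different sections makes one statement serve for independence of the
  section, independence of the representative, and injectivity.\<close>

lemma crossed_equiv_iff:
  assumes c: "c \<in> CS" and c': "c' \<in> CS" and s: "s \<in> sections" and s': "s' \<in> sections"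
  shows "(c, c') \<in> CE \<longleftrightarrow> (cp s c, cp s' c') \<in> Coh"
proof -
  obtain ra la f brg where c_eq: "c = (ra, la, f, brg)" by (metis prod_cases4)
  obtain ra' la' f' brg' where c'_eq: "c' = (ra', la', f', brg')" by (metis prod_cases4)
  note D = crossed_systemD[OF c[unfolded c_eq]]
  note D' = crossed_systemD[OF c'[unfolded c'_eq]]
  interpret s: Vector_Spaces.linear sL sE s by (rule sectionD(1)[OF s])
  interpret s': Vector_Spaces.linear sL sE s' by (rule sectionD(1)[OF s'])
  note [simp] = sectionD(2)[OF s] sectionD(2)[OF s']
  have G0 [simp]: "0 \<in> G" by (simp add: mem_G)
  note zero = D(1-4)[THEN bilinear_on_zero(1), simplified] D(1-4)[THEN bilinear_on_zero(2), simplified]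
    D'(1-4)[THEN bilinear_on_zero(1), simplified] D'(1-4)[THEN bilinear_on_zero(2), simplified]
    bilinear_on_zero[OF L.bilinear_bracket, simplified]
  note add = D'(1-4)[THEN bilinear_onD(2)] D'(1-4)[THEN bilinear_onD(3)]
  \<comment> \<open>Every vector is \<open>g + s x\<close> with \<open>g\<close> in
    \<open>G\<close>, so brackets need comparing only on such sums.\<close>
  have cp: "cp s c (g + s x, h + s y) =
      brg (g, h) + la (x, h) + ra (g, y) + f (x, y) + s (brL (x, y))"
    if "g \<in> G" "h \<in> G" for g h x y
    using that by (simp add: c_eq crossed_product_on_eq[OF s] \<pi>.add mem_G)
  have cp': "cp s' c' (g + s' x, h + s' y) =
      brg' (g, h) + la' (x, h) + ra' (g, y) + f' (x, y) + s' (brL (x, y))"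
    if "g \<in> G" "h \<in> G" for g h x y
    using that by (simp add: c'_eq crossed_product_on_eq[OF s'] \<pi>.add mem_G)
  have Gs: "g + h \<in> G" if "g \<in> G" "h \<in> G" for g h
    using that by (simp add: mem_G \<pi>.add)
  \<comment> \<open>This lets the formula for \<open>\<phi>\<close> on sums \<open>g + s x\<close>
    apply to the value of the bracket itself.\<close>
  have closed: "brg (g, h) + la (x, h) + ra (g, y) + f (x, y) \<in> G"
    if "g \<in> G" "h \<in> G" for g h x y
    using that D(1-4)[THEN bilinear_onD(1)] by (intro Gs) auto
  show ?thesis
  proof
    assume "(c, c') \<in> CE"
    then obtain r where beq: "brg = brg'" and lr: "Vector_Spaces.linear sL sE r"
      and rG: "\<And>x. r x \<in> G"
      and era: "\<And>g x. g \<in> G \<Longrightarrow> ra (g, x) = ra' (g, x) + brg (g, r x)"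
      and ela: "\<And>g x. g \<in> G \<Longrightarrow> la (x, g) = la' (x, g) + brg (r x, g)"
      and ef: "\<And>x y. f (x, y) =
         f' (x, y) + brg (r x, r y) - r (brL (x, y)) + la' (x, r y) + ra' (r x, y)"
      unfolding crossed_equiv_def c_eq c'_eq by blast
    interpret r: Vector_Spaces.linear sL sE r by (rule lr)
    have \<pi>r: "\<pi> (r x) = 0" for x using rG by (simp add: mem_G)
    define \<phi> where "\<phi> u = (u - s (\<pi> u)) + r (\<pi> u) + s' (\<pi> u)" for u
    have \<phi>: "\<phi> (g + s x) = (g + r x) + s' x" if "g \<in> G" for g x
      using that by (simp add: \<phi>_def \<pi>.add mem_G)
    have lin: "Vector_Spaces.linear sE sE \<phi>"
      by (simp add: linear_E \<phi>_def \<pi>.add \<pi>.scale s.add s.scale s'.add s'.scale r.add r.scale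
          E.scale_right_distrib E.scale_right_diff_distrib)
    have "\<phi> (cp s c (g + s x, h + s y)) = cp s' c' (\<phi> (g + s x), \<phi> (h + s y))"
      if "g \<in> G" "h \<in> G" for g h x y
    proof -
      have "\<phi> (cp s c (g + s x, h + s y)) =
          brg (g, h) + la (x, h) + ra (g, y) + f (x, y) + r (brL (x, y)) + s' (brL (x, y))"
        by (simp only: cp[OF that] \<phi>[OF closed[OF that]])
      moreover have "cp s' c' (\<phi> (g + s x), \<phi> (h + s y)) =
          brg' (g + r x, h + r y) + la' (x, h + r y) + ra' (g + r x, y) + f' (x, y)
            + s' (brL (x, y))"
        using that by (simp only: \<phi> cp' Gs rG)
      \<comment> \<open>Expanding the right side by bilinearity and substituting \<open>era\<close>,
        \<open>ela\<close>, \<open>ef\<close> on the left matches all terms;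
        \<open>r (brL (x, y))\<close> cancels.\<close>
      ultimately show ?thesis
        using that by (simp add: Gs rG era ela ef add beq algebra_simps)
    qed
    from this[OF minus_section_mem[OF s] minus_section_mem[OF s]]
    have "\<phi> (cp s c (u, v)) = cp s' c' (\<phi> u, \<phi> v)" for u v
      by (metis diff_add_cancel)
    moreover have "\<forall>g. \<pi> g = 0 \<longrightarrow> \<phi> g = g" by (simp add: \<phi>_def)
    moreover have "\<pi> \<circ> \<phi> = \<pi>"
      by (simp add: fun_eq_iff \<phi>_def \<pi>.add \<pi>.diff \<pi>r)
    ultimately show "(cp s c, cp s' c') \<in> Coh"
      using lin crossed_product_in_Ext[OF c s] crossed_product_in_Ext[OF c' s']
      by (auto simp: cohomologous_def leibniz_hom_def)
  next
    assume "(cp s c, cp s' c') \<in> Coh"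
    then obtain \<phi> where "leibniz_hom sE (cp s c) sE (cp s' c') \<phi>"
      and k: "\<And>g. g \<in> G \<Longrightarrow> \<phi> g = g" and p: "\<And>u. \<pi> (\<phi> u) = \<pi> u"
      by (auto simp: cohomologous_def fun_eq_iff mem_G)
    then have lin: "Vector_Spaces.linear sE sE \<phi>"
      and mor: "\<And>u v. \<phi> (cp s c (u, v)) = cp s' c' (\<phi> u, \<phi> v)"
      by (auto simp: leibniz_hom_def)
    interpret \<phi>: Vector_Spaces.linear sE sE \<phi> by (rule lin)
    \<comment> \<open>Both \<open>\<phi> \<circ> s\<close> and \<open>s'\<close> are sections of
      \<open>\<pi>\<close>, so their difference lands in \<open>G\<close>.\<close>
    define r where "r x = \<phi> (s x) - s' x" for x
    have lr: "Vector_Spaces.linear sL sE r"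
      by (simp add: linear_LE r_def s.add s.scale s'.add s'.scale \<phi>.add \<phi>.scale
          E.scale_right_diff_distrib)
    interpret r: Vector_Spaces.linear sL sE r by (rule lr)
    have rG: "r x \<in> G" for x by (simp add: mem_G r_def \<pi>.diff p)
    have \<phi>: "\<phi> (g + s x) = (g + r x) + s' x" if "g \<in> G" for g x
      using that by (simp add: r_def \<phi>.add k)
    \<comment> \<open>The morphism condition with \<open>s' (brL (x, y))\<close> cancelled. Setting
      suitable arguments to \<open>0\<close> isolates each of the four conditions.\<close>
    have key: "brg (g, h) + la (x, h) + ra (g, y) + f (x, y) + r (brL (x, y)) =
        brg' (g + r x, h + r y) + la' (x, h + r y) + ra' (g + r x, y) + f' (x, y)"
      if "g \<in> G" "h \<in> G" for g h x y
      using mor[of "g + s x" "h + s y"] that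
      by (simp add: cp cp' \<phi> closed Gs rG)
    have b: "brg (g, h) = brg' (g, h)" if "g \<in> G" "h \<in> G" for g h
      using key[OF that, of 0 0] that by (simp add: zero)
    \<comment> \<open>Agreement is known on \<open>G \<times> G\<close> only; extensionality turns
      it into equality of functions.\<close>
    have beq: "brg = brg'"
      by (rule extensionalityI[OF D(5) D'(5)]) (auto simp: b)
    have "ra (g, x) = ra' (g, x) + brg (g, r x)" if "g \<in> G" for g x
      using key[OF that G0, of 0 x] that by (simp add: zero beq rG add.commute)
    moreover have "la (x, g) = la' (x, g) + brg (r x, g)" if "g \<in> G" for g x
      using key[OF G0 that, of x 0] that by (simp add: zero beq rG add.commute)
    moreover have "f (x, y) =
        f' (x, y) + brg (r x, r y) - r (brL (x, y)) + la' (x, r y) + ra' (r x, y)" for x y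
      using key[OF G0 G0, of x y] by (simp add: zero beq rG algebra_simps)
    ultimately show "(c, c') \<in> CE"
      using c c' beq lr rG by (auto simp: crossed_equiv_def c_eq c'_eq)
  qed
qed

section \<open>Passage to equivalence classes\<close>

lemma CE_subset: "CE \<subseteq> CS \<times> CS"
  by (auto simp: crossed_equiv_def)

text \<open>For a fixed section, the relation is the pullback of \<open>Coh\<close> along
  \<open>cp s\<close>, so its properties are inherited without computing with the maps
  \<open>r\<close>.\<close>

lemma equiv_CE: "equiv CS CE"
proof -
  obtain s where s: "s \<in> sections" using section_exists by blast
  have iff: "(c, c') \<in> CE \<longleftrightarrow> c \<in> CS \<and> c' \<in> CS \<and> (cp s c, cp s c') \<in> Coh" for c c'
    using CE_subset crossed_equiv_iff[OF _ _ s s] by blast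
  from equiv_Coh have "refl_on Ext Coh" "sym Coh" "trans Coh"
    by (auto elim: equivE)
  then show ?thesis
    by (intro equivI CE_subset refl_onI symI transI)
       (auto simp: iff refl_on_def crossed_product_in_Ext[OF _ s] dest: symD transD)
qed

text \<open>All members of the defining union are the same class, and the union is nonempty because
  \<open>c\<close> and \<open>s\<close> are themselves indices.\<close>

lemma GHL2_to_Gext_class:
  assumes c: "c \<in> CS" and s: "s \<in> sections"
  shows "GHL2_to_Gext sL brL sE \<pi> (CE `` {c}) = Coh `` {cp s c}"
proof -
  have "Coh `` {cp s' c'} = Coh `` {cp s c}" if "c' \<in> CE `` {c}" "s' \<in> sections" for c' s'
  proof -
    have "c' \<in> CS" "(c, c') \<in> CE" using that CE_subset by auto
    then have "(cp s c, cp s' c') \<in> Coh"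
      using crossed_equiv_iff c s that(2) by blast
    then show ?thesis using equiv_class_eq[OF equiv_Coh] by blast
  qed
  moreover have "c \<in> CE `` {c}" using equiv_class_self[OF equiv_CE c] .
  ultimately show ?thesis using s unfolding GHL2_to_Gext_def by blast
qed

text \<open>With one section fixed, injectivity is the direction of \<open>crossed_equiv_iff\<close>
  from \<open>Coh\<close> to \<open>CE\<close>, and surjectivity comes from
  \<open>crossed_product_surj\<close>.\<close>

lemma bij_GHL2_to_Gext:
  "bij_betw (GHL2_to_Gext sL brL sE \<pi>) (GHL2 sL brL sE G) (Gext sL brL sE \<pi>)"
proof -
  obtain s where s: "s \<in> sections" using section_exists by blast
  note cls = GHL2_to_Gext_class[OF _ s]
  show ?thesis
    unfolding bij_betw_def
  proof
    show "inj_on (GHL2_to_Gext sL brL sE \<pi>) (GHL2 sL brL sE G)"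
    proof (rule inj_onI)
      fix X Y assume "X \<in> GHL2 sL brL sE G" "Y \<in> GHL2 sL brL sE G"
        and eq: "GHL2_to_Gext sL brL sE \<pi> X = GHL2_to_Gext sL brL sE \<pi> Y"
      then obtain c d where c: "c \<in> CS" "X = CE `` {c}" and d: "d \<in> CS" "Y = CE `` {d}"
        unfolding GHL2_def by (metis quotientE)
      from eq have "(cp s c, cp s d) \<in> Coh"
        unfolding c d cls[OF c(1)] cls[OF d(1)]
        using eq_equiv_class[OF _ equiv_Coh] crossed_product_in_Ext[OF d(1) s] by blast
      then have "(c, d) \<in> CE" using crossed_equiv_iff[OF c(1) d(1) s s] by blast
      then show "X = Y" unfolding c d by (rule equiv_class_eq[OF equiv_CE])
    qed
    show "GHL2_to_Gext sL brL sE \<pi> ` GHL2 sL brL sE G = Gext sL brL sE \<pi>"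
    proof (intro equalityI subsetI)
      fix X assume "X \<in> GHL2_to_Gext sL brL sE \<pi> ` GHL2 sL brL sE G"
      then obtain c where "c \<in> CS" "X = Coh `` {cp s c}"
        unfolding GHL2_def by (auto elim!: quotientE simp: cls)
      then show "X \<in> Gext sL brL sE \<pi>"
        unfolding Gext_def by (auto intro: quotientI crossed_product_in_Ext[OF _ s])
    next
      fix X assume "X \<in> Gext sL brL sE \<pi>"
      then obtain br where "br \<in> Ext" "X = Coh `` {br}"
        unfolding Gext_def by (rule quotientE)
      then obtain c where "c \<in> CS" "X = GHL2_to_Gext sL brL sE \<pi> (CE `` {c})"
        using crossed_product_surj[OF _ s] cls by metis
      then show "X \<in> GHL2_to_Gext sL brL sE \<pi> ` GHL2 sL brL sE G"
        unfolding GHL2_def by (auto intro: quotientI)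
    qed
  qed
qed

end

theorem theorem2p5:
  fixes sL :: "'k::field \<Rightarrow> 'l::ab_group_add \<Rightarrow> 'l"
    and brL :: "'l \<times> 'l \<Rightarrow> 'l"
    and sE :: "'k \<Rightarrow> 'e::ab_group_add \<Rightarrow> 'e"
    and \<pi> :: "'e \<Rightarrow> 'l"
    and G :: "'e set"
  assumes "leibniz_algebra sL UNIV brL"
    and "vector_space sE"
    and "Vector_Spaces.linear sE sL \<pi>"
    and "surj \<pi>"
    and "G = {e. \<pi> e = 0}"
  shows "equiv (crossed_systems sL brL sE G) (crossed_equiv sL brL sE G) \<and>
    (\<forall>c \<in> crossed_systems sL brL sE G. \<forall>s \<in> linear_sections sL sE \<pi>.
       GHL2_to_Gext sL brL sE \<pi> (crossed_equiv sL brL sE G `` {c}) =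
         cohomologous sL brL sE \<pi> `` {crossed_product_on brL \<pi> s c}) \<and>
    bij_betw (GHL2_to_Gext sL brL sE \<pi>) (GHL2 sL brL sE G) (Gext sL brL sE \<pi>)"
proof -
  have "leibniz_extension sL brL sE \<pi> G"
    unfolding leibniz_extension_def leibniz_extension_axioms_def using assms by blast
  then interpret leibniz_extension sL brL sE \<pi> G .
  show ?thesis
    using equiv_CE GHL2_to_Gext_class bij_GHL2_to_Gext by blast
qed

end
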